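(* Bayesian network structure learning (BNSL) based on the BDeu scores is not regular. That is, for every equivalent sample size $\delta>0$, there exist a finite set $V$ of finite-valued variables, a variable $X\in V$, sets $U\subseteq U'\subseteq V\setminus\{X\}$, an integer $n\geq 1$ and $n$ examples of the variables in $V$ such that $H^n(X|U)\le H^n(X|U')$ but $Q^n(X|U)<Q^n(X|U')$, where $Q^n(\cdot|\cdot)$ is the BDeu conditional score with equivalent sample size $\delta$.
   Context: $V$ is a finite set of variables each taking finitely many values. A subset $S\subseteq V$ is viewed as a single variable whose values are the tuples of values of its members (the empty set takes exactly one value). Given $n$ examples (tuples of values of all variables in $V$), $c(s)$ denotes the number of examples in which the value $s$ of $S$ occurs. The BDeu score of $S$ with equivalent sample size $\delta>0$ is $$Q^n(S)=\frac{\Gamma(\delta)}{\Gamma(n+\delta)}\prod_s\frac{\Gamma(c(s)+\frac{\delta}{m})}{\Gamma(\frac{\delta}{m})},$$ where $m$ is the number of values $S$ can take and $s$ ranges over these $m$ values; $\delta$ is the same for all $S$. For $X\in V$ and $U\subseteq V\setminus\{X\}$, the conditional score is $Q^n(X|U):=Q^n(\{X\}\cup U)/Q^n(U)$. The empirical entropy of $X$ given $U$ is $$H^n(X|U):=\sum_x\sum_u-\frac{c(x,u)}{n}\log\frac{c(x,u)}{c(u)},$$ where $c(u)$ and $c(x,u)$ are the numbers of occurrences of $U=u$ and $(X,U)=(x,u)$ in the $n$ examples (terms with $c(x,u)=0$ are $0$). In score-based BNSL one seeks, for each variable $X$, a parent set $U$ maximizing $Q^n(X|U)$. BNSL (with a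 given score) is called regular if $H^n(X|U)\le H^n(X|U')$ and $U\subseteq U'$ imply $Q^n(X|U)\ge Q^n(X|U')$. *)

theory Defs
  imports "HOL-Analysis.Gamma_Function" "HOL-Library.FuncSet"
begin

text \<open>
  A variable \<open>v\<close> ranges over the set \<open>Val v\<close>. The values of a set \<open>S\<close> of variables are
  the extensional functions in \<open>PiE S Val\<close>; in particular \<open>S = {}\<close> has exactly one value.
  The list \<open>D\<close> of examples has length \<open>n\<close> (repetitions are counted).
\<close>

definition occurrences :: "('v \<Rightarrow> 'a) list \<Rightarrow> 'v set \<Rightarrow> ('v \<Rightarrow> 'a) \<Rightarrow> nat" where
  "occurrences D S s = length (filter (\<lambda>e. restrict e S = s) D)"

definition bdeu :: "real \<Rightarrow> ('v \<Rightarrow> 'a set) \<Rightarrow> ('v \<Rightarrow> 'a) list \<Rightarrow> 'v set \<Rightarrow> real" where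
  "bdeu \<delta> Val D S =
     (let n = real (length D); m = real (card (PiE S Val))
      in Gamma \<delta> / Gamma (n + \<delta>) *
         (\<Prod>s\<in>PiE S Val. Gamma (real (occurrences D S s) + \<delta> / m) / Gamma (\<delta> / m)))"

text \<open>A conditional score maps value sets, examples, \<open>X\<close> and \<open>U\<close> to the score of \<open>X\<close> given \<open>U\<close>.\<close>

type_synonym ('v, 'a) cond_score =
  "('v \<Rightarrow> 'a set) \<Rightarrow> ('v \<Rightarrow> 'a) list \<Rightarrow> 'v \<Rightarrow> 'v set \<Rightarrow> real"

definition bdeu_cond :: "real \<Rightarrow> ('v, 'a) cond_score" where
  "bdeu_cond \<delta> Val D X U = bdeu \<delta> Val D (insert X U) / bdeu \<delta> Val D U"

text \<open>
  For \<open>X \<notin> U\<close>, the pair \<open>(x, u)\<close> of values of \<open>X\<close> and \<open>U\<close> is the value \<open>u(X := x)\<close> of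
  \<open>insert X U\<close>. Terms with \<open>c(x,u) = 0\<close> vanish because of the factor \<open>c(x,u) / n\<close>.
\<close>

definition cond_entropy ::
    "('v \<Rightarrow> 'a set) \<Rightarrow> ('v \<Rightarrow> 'a) list \<Rightarrow> 'v \<Rightarrow> 'v set \<Rightarrow> real" where
  "cond_entropy Val D X U =
     (\<Sum>x\<in>Val X. \<Sum>u\<in>PiE U Val.
        - (real (occurrences D (insert X U) (u(X := x))) / real (length D)) *
          ln (real (occurrences D (insert X U) (u(X := x))) / real (occurrences D U u)))"

definition regular_score :: "('v, 'a) cond_score \<Rightarrow> bool" where
  "regular_score Q \<longleftrightarrow>
     (\<forall>V Val D X U U'.
        finite V \<and> (\<forall>v\<in>V. finite (Val v) \<and> Val v \<noteq> {}) \<and>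
        length D \<ge> 1 \<and> set D \<subseteq> PiE V Val \<and>
        X \<in> V \<and> U \<subseteq> V - {X} \<and> U' \<subseteq> V - {X} \<and>
        cond_entropy Val D X U \<le> cond_entropy Val D X U' \<and> U \<subseteq> U'
        \<longrightarrow> Q Val D X U \<ge> Q Val D X U')"

end

(* When all n examples coincide, every conditional entropy vanishes, while the BDeu score of S
   is the quotient of Pochhammer symbols (delta/m)_n / (delta)_n, with m the number of values
   of S. For binary X and Y, U = {}, U' = {Y} and n = 2, the claim reduces to
   (1 + delta/2) / (1 + delta) < (1 + delta/4) / (1 + delta/2): spreading delta over the values
   of Y lowers the effective sample size, so a repeated value of X is penalised less. *)
theory Submission
  imports Defs
begin

lemma occurrences_replicate:
  "occurrences (replicate n e) S s = (if restrict e S = s then n else 0)"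
  by (simp add: occurrences_def filter_replicate)

text \<open>Only the value \<open>restrict e S\<close> has a nonzero count. Every other factor of
  the product is a Gamma quotient equal to 1, and the remaining ones are rising factorials.\<close>

lemma bdeu_replicate:
  assumes \<delta>: "\<delta> > 0" and fin: "finite (PiE S Val)" and e: "restrict e S \<in> PiE S Val"
  shows "bdeu \<delta> Val (replicate n e) S =
    pochhammer (\<delta> / real (card (PiE S Val))) n / pochhammer \<delta> n"
proof -
  define d where "d = \<delta> / real (card (PiE S Val))"
  have "card (PiE S Val) > 0"
    using fin e card_gt_0_iff by blast
  with \<delta> have d: "d > 0" by (simp add: d_def)
  have poch: "pochhammer z n = Gamma (real n + z) / Gamma z" if "z > 0" for z :: real
    using that pochhammer_Gamma[of z n] nonpos_Ints_nonpos[of z] by (auto simp: add.commute)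
  have "(\<Prod>s\<in>PiE S Val. Gamma (real (occurrences (replicate n e) S s) + d) / Gamma d)
      = (\<Prod>s\<in>PiE S Val. if restrict e S = s then Gamma (real n + d) / Gamma d else 1)"
    using Gamma_real_pos[OF d] by (intro prod.cong) (auto simp: occurrences_replicate)
  also have "\<dots> = pochhammer d n"
    using fin e d by (simp add: prod.delta' poch)
  finally show ?thesis
    using \<delta> by (simp add: bdeu_def Let_def poch flip: d_def)
qed

text \<open>A term with \<open>c(x,u) > 0\<close> has \<open>c(x,u) = c(u) = n\<close>, so its
  logarithm is \<open>ln 1\<close>.\<close>

lemma cond_entropy_replicate:
  assumes "X \<notin> U"
  shows "cond_entropy Val (replicate n e) X U = 0"
proof -
  have "restrict e U = u"
    if "u \<in> PiE U Val" "restrict e (insert X U) = u(X := x)" for x u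
  proof
    \<comment> \<open>At \<open>v = X\<close> both sides are \<open>undefined\<close>, as
      \<open>X \<notin> U\<close>.\<close>
    fix v
    show "restrict e U v = u v"
      using fun_cong[OF that(2), of v] PiE_arb[OF that(1), of v] assms
      by (auto simp: restrict_def split: if_splits)
  qed
  then show ?thesis
    by (auto simp: cond_entropy_def occurrences_replicate intro!: sum.neutral)
qed

theorem theorem3:
  fixes \<delta> :: real
  assumes "\<delta> > 0"
  shows "\<not> regular_score (bdeu_cond \<delta> :: (nat, nat) cond_score)"
proof
  assume reg: "regular_score (bdeu_cond \<delta> :: (nat, nat) cond_score)"
  define V :: "nat set" where "V = {0, 1}"
  define Val :: "nat \<Rightarrow> nat set" where "Val = (\<lambda>_. {0, 1})"
  define e :: "nat \<Rightarrow> nat" where "e = (\<lambda>v\<in>V. 0)"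
  define D where "D = replicate 2 e"
  have poch: "pochhammer z 2 = z * (z + 1)" for z :: real
    by (simp add: numeral_2_eq_2 pochhammer_Suc)
  have bdeu: "bdeu \<delta> Val D S = (1 + \<delta> / 2 ^ card S) / (2 ^ card S * (1 + \<delta>))"
    if "S \<subseteq> V" for S
  proof -
    have fin: "finite S" using that finite_subset by (auto simp: V_def)
    then have "card (PiE S Val) = 2 ^ card S"
      by (simp add: card_PiE Val_def flip: numeral_2_eq_2)
    moreover have "bdeu \<delta> Val D S =
        pochhammer (\<delta> / real (card (PiE S Val))) 2 / pochhammer \<delta> 2"
      unfolding D_def using fin that assms
      by (intro bdeu_replicate) (auto intro!: finite_PiE simp: Val_def e_def)
    ultimately show ?thesis
      using assms by (simp add: poch divide_simps add_eq_0_iff) (simp add: algebra_simps)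
  qed
  have "cond_entropy Val D 0 U = 0" if "0 \<notin> U" for U
    using that unfolding D_def by (rule cond_entropy_replicate)
  \<comment> \<open>Both entropies are 0, so the entropy hypothesis of regularity holds with
    equality.\<close>
  then have reg': "bdeu_cond \<delta> Val D 0 {1} \<le> bdeu_cond \<delta> Val D 0 {}"
    by (intro reg[unfolded regular_score_def, rule_format, of V])
      (auto simp: D_def V_def Val_def e_def)
  have "bdeu_cond \<delta> Val D 0 {} = (1 + \<delta> / 2) / (1 + \<delta>) / 2"
    using assms by (simp add: bdeu_cond_def bdeu V_def)
  \<comment> \<open>After cross-multiplication, \<open>(1 + \<delta>) * (1 + \<delta> / 4)\<close>
    exceeds \<open>(1 + \<delta> / 2)^2\<close> by exactly \<open>\<delta> / 4\<close>.\<close>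
  also have "\<dots> < (1 + \<delta> / 4) / (1 + \<delta> / 2) / 2"
    using assms by (simp add: field_simps)
  also have "\<dots> = bdeu_cond \<delta> Val D 0 {1}"
    using assms by (simp add: bdeu_cond_def bdeu V_def divide_simps) (simp add: algebra_simps)
  also note reg'
  finally show False by simp
qed

end
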